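(* Let $A,B$ be two positive semidefinite matrices with $A\preceq B$, i.e. $B-A$ is positive semidefinite. Then the following statements are equivalent: (i) there exists a positive definite weight matrix $G_0$ such that $\operatorname{Tr}(G_0A)=\operatorname{Tr}(G_0B)$; (ii) $A=B$; (iii) for every positive definite weight matrix $G$, $\operatorname{Tr}(GA)=\operatorname{Tr}(GB)$; (iv) there exists a positive definite weight matrix $G_0$ such that $\operatorname{Tr}(G_0A^{-1})=\operatorname{Tr}(G_0B^{-1})$; (v) for every positive definite matrix $G$, $\operatorname{Tr}(GA^{-1})=\operatorname{Tr}(GB^{-1})$.
   Context: All matrices are square and of the same size. A weight matrix is simply a positive definite matrix $G$ used to form the scalars $\operatorname{Tr}(GA)$, etc. $A^{-1}$ and $B^{-1}$ are the inverses of $A$ and $B$.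
   Formalization: Statements (iv) and (v) are claimed equivalent to the others only when A and B are both invertible, since A⁻¹ and B⁻¹ do not exist for singular positive semidefinite matrices (e.g. A = B = 0); the equivalence of (i), (ii), (iii) holds for all positive semidefinite A ⪯ B. *)

theory Defs
  imports "HOL-Analysis.Analysis" "Jordan_Normal_Form.Conjugate"
begin

text \<open>
  Real and complex matrices are treated together: both scalar types have the sort
  \<open>{real_normed_field, conjugatable_ordered_field, ordered_comm_ring}\<close>. On \<open>real\<close>,
  \<open>conjugate\<close> is the identity; on \<open>complex\<close> it is \<open>cnj\<close>, and \<open>0 \<le> z\<close> means that
  \<open>z\<close> is real and nonnegative.
\<close>

definition hermitian :: "'a::conjugate^'n^'n \<Rightarrow> bool"
  where "hermitian A \<longleftrightarrow> (\<forall>i j. A $ i $ j = conjugate (A $ j $ i))"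

definition quad_form :: "'a::conjugatable_ordered_field^'n^'n \<Rightarrow> 'a^'n \<Rightarrow> 'a"
  where "quad_form A x = (\<Sum>i\<in>UNIV. conjugate (x $ i) * (A *v x) $ i)"

text \<open>
  Hermitian symmetry is required explicitly: over the reals it does not follow from the sign
  condition on the quadratic form.
\<close>

definition pos_semidef :: "'a::conjugatable_ordered_field^'n^'n \<Rightarrow> bool"
  where "pos_semidef A \<longleftrightarrow> hermitian A \<and> (\<forall>x. 0 \<le> quad_form A x)"

definition pos_def :: "'a::conjugatable_ordered_field^'n^'n \<Rightarrow> bool"
  where "pos_def A \<longleftrightarrow> hermitian A \<and> (\<forall>x. x \<noteq> 0 \<longrightarrow> 0 < quad_form A x)"

definition loewner_le :: "'a::conjugatable_ordered_field^'n^'n \<Rightarrow> 'a^'n^'n \<Rightarrow> bool"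
    (infix \<open>\<preceq>\<^sub>L\<close> 50)
  where "A \<preceq>\<^sub>L B \<longleftrightarrow> pos_semidef (B - A)"

lemma pos_semidef_real_iff:
  fixes A :: "real^'n^'n"
  shows "pos_semidef A \<longleftrightarrow> transpose A = A \<and> (\<forall>x. 0 \<le> x \<bullet> (A *v x))"
  by (auto simp: pos_semidef_def hermitian_def quad_form_def inner_vec_def transpose_def vec_eq_iff)

lemma pos_def_real_iff:
  fixes A :: "real^'n^'n"
  shows "pos_def A \<longleftrightarrow> transpose A = A \<and> (\<forall>x. x \<noteq> 0 \<longrightarrow> 0 < x \<bullet> (A *v x))"
  by (auto simp: pos_def_def hermitian_def quad_form_def inner_vec_def transpose_def vec_eq_iff)

lemma pos_semidef_complex_iff:
  fixes A :: "complex^'n^'n"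
  shows "pos_semidef A \<longleftrightarrow> (\<forall>i j. A $ i $ j = cnj (A $ j $ i)) \<and>
    (\<forall>x. (\<Sum>i\<in>UNIV. cnj (x $ i) * (A *v x) $ i) \<in> \<real>\<^sub>\<ge>\<^sub>0)"
  by (auto simp: pos_semidef_def hermitian_def quad_form_def less_eq_complex_def
      complex_nonneg_Reals_iff)

end

theory Submission
  imports Defs
begin

text \<open>
  The core is that \<open>trace (G ** P) > 0\<close> for \<open>G\<close> positive definite and \<open>P \<noteq> 0\<close> positive
  semidefinite. If \<open>P $ k $ k = a \<noteq> 0\<close>, splitting off the rank-one matrix
  \<open>p p\<^sup>* / a\<close>, with \<open>p\<close> the \<open>k\<close>-th column of \<open>P\<close>, contributes \<open>quad_form G p / a > 0\<close> to the
  trace and leaves a positive semidefinite matrix with one more vanishing diagonal entry; a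
  positive semidefinite matrix with zero diagonal is zero. Apply this to \<open>B - A\<close> and, since
  inversion reverses the Loewner order, to \<open>A\<^sup>-\<^sup>1 - B\<^sup>-\<^sup>1\<close>. No spectral theorem is used, so the
  argument works over any scalar field of the given sort.
\<close>

section \<open>Conjugation and order in the scalar field\<close>

lemma conjugate_one [simp]: "conjugate (1 :: 'a::conjugatable_field) = 1"
  by (metis conjugate_dist_mul conjugate_zero_iff mult_cancel_left2 one_neq_zero)

lemma conjugate_diff: "conjugate (x - y :: 'a::conjugatable_ring) = conjugate x - conjugate y"
  by (metis conjugate_dist_add conjugate_neg diff_conv_add_uminus)

lemma conjugate_divide:
  "conjugate (x / y :: 'a::conjugatable_field) = conjugate x / conjugate y"
proof (cases "y = 0")
  case False
  then have "conjugate (x / y) * conjugate y = conjugate x"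
    by (simp flip: conjugate_dist_mul)
  with False show ?thesis by (simp add: eq_divide_eq)
qed simp

lemma zero_less_one_conjugatable: "0 < (1 :: 'a::conjugatable_ordered_field)"
  using conjugate_square_greater_0[of "1 :: 'a"] by simp

text \<open>The inverse is \<open>a\<close> times the square modulus of \<open>inverse a\<close>,
  hence a product of two nonnegative scalars.\<close>

lemma zero_less_inverse_if_conjugate_eq:
  fixes a :: "'a::{conjugatable_ordered_field, ordered_comm_ring}"
  assumes "0 < a" and "conjugate a = a"
  shows "0 < inverse a"
proof -
  have "inverse a = a * (inverse a * conjugate (inverse a))"
    using assms by (simp add: inverse_eq_divide conjugate_divide)
  then have "0 \<le> inverse a"
    using assms conjugate_square_positive[of "inverse a"]
    by (metis less_le mult_nonneg_nonneg)
  then show ?thesis using assms by (simp add: less_le)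
qed

section \<open>The standard Hermitian inner product\<close>

definition hinner :: "'a::conjugatable_ring^'n \<Rightarrow> 'a^'n \<Rightarrow> 'a"
  where "hinner x y = (\<Sum>i\<in>UNIV. conjugate (x $ i) * y $ i)"

lemma quad_form_hinner: "quad_form A x = hinner x (A *v x)"
  by (simp add: quad_form_def hinner_def)

lemma hinner_add_left: "hinner (x + y) z = hinner x z + hinner y z"
  by (simp add: hinner_def conjugate_dist_add algebra_simps sum.distrib)

lemma hinner_add_right: "hinner x (y + z) = hinner x y + hinner x z"
  by (simp add: hinner_def algebra_simps sum.distrib)

lemma hinner_diff_left: "hinner (x - y) z = hinner x z - hinner y z"
  by (simp add: hinner_def conjugate_diff algebra_simps sum_subtractf)

lemma hinner_diff_right: "hinner x (y - z) = hinner x y - hinner x z"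
  by (simp add: hinner_def algebra_simps sum_subtractf)

lemma hinner_scale_left: "hinner (c *s x) y = conjugate c * hinner x (y :: 'a::conjugatable_field^'n)"
  by (simp add: hinner_def conjugate_dist_mul sum_distrib_left mult.assoc)

lemma hinner_scale_right: "hinner x (c *s y) = c * hinner x (y :: 'a::conjugatable_field^'n)"
  by (simp add: hinner_def sum_distrib_left mult_ac)

lemma hinner_commute: "hinner x y = conjugate (hinner y (x :: 'a::conjugatable_field^'n))"
  by (simp add: hinner_def sum_conjugate conjugate_dist_mul mult.commute)

lemma hinner_axis_left: "hinner (axis k 1) (x :: 'a::conjugatable_field^'n) = x $ k"
  by (simp add: hinner_def axis_def if_distrib if_distribR cong: if_cong)

lemma matrix_vector_mult_axis: "(A *v axis k 1) $ i = (A :: 'a::semiring_1^'n^'m) $ i $ k"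
  by (simp add: matrix_vector_mult_def axis_def if_distrib if_distribR cong: if_cong)

lemma hinner_self_nonneg: "0 \<le> hinner x (x :: 'a::conjugatable_ordered_field^'n)"
  unfolding hinner_def by (rule sum_nonneg) (metis conjugate_square_positive mult.commute)

lemma hinner_self_eq_0_iff:
  "hinner x x = 0 \<longleftrightarrow> x = (0 :: 'a::conjugatable_ordered_field^'n)"
proof -
  have "0 \<le> conjugate (x $ i) * x $ i" for i
    by (metis conjugate_square_positive mult.commute)
  then show ?thesis
    by (simp add: hinner_def sum_nonneg_eq_0_iff vec_eq_iff)
qed

section \<open>Hermitian matrices and their quadratic forms\<close>

text \<open>Self-adjointness, the coordinate-free form used later for differences, quadratic forms
  and inverses. One direction exchanges a double sum, the other tests on unit vectors.\<close>

lemma hermitian_iff_hinner: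
  fixes A :: "'a::conjugatable_field^'n^'n"
  shows "hermitian A \<longleftrightarrow> (\<forall>x y. hinner x (A *v y) = hinner (A *v x) y)"
proof
  assume "hermitian A"
  then have c: "conjugate (A $ i $ j) = A $ j $ i" for i j
    unfolding hermitian_def by metis
  show "\<forall>x y. hinner x (A *v y) = hinner (A *v x) y"
  proof (intro allI)
    fix x y
    have "hinner x (A *v y) = (\<Sum>i\<in>UNIV. \<Sum>j\<in>UNIV. conjugate (x $ i) * A $ i $ j * y $ j)"
      by (simp add: hinner_def matrix_vector_mult_def sum_distrib_left mult.assoc)
    also have "\<dots> = (\<Sum>j\<in>UNIV. \<Sum>i\<in>UNIV. conjugate (x $ i) * A $ i $ j * y $ j)"
      by (rule sum.swap)
    also have "\<dots> = hinner (A *v x) y"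
      by (simp add: hinner_def matrix_vector_mult_def sum_conjugate conjugate_dist_mul c
          sum_distrib_left sum_distrib_right mult_ac)
    finally show "hinner x (A *v y) = hinner (A *v x) y" .
  qed
next
  assume *: "\<forall>x y. hinner x (A *v y) = hinner (A *v x) y"
  show "hermitian A"
    unfolding hermitian_def
  proof (intro allI)
    fix i j
    show "A $ i $ j = conjugate (A $ j $ i)"
      using *[rule_format, of "axis i 1" "axis j 1"]
        hinner_commute[of "A *v axis i 1" "axis j 1"]
      by (simp add: hinner_axis_left matrix_vector_mult_axis)
  qed
qed

lemma hermitian_diff:
  fixes A B :: "'a::conjugatable_field^'n^'n"
  shows "hermitian A \<Longrightarrow> hermitian B \<Longrightarrow> hermitian (A - B)"
  by (simp add: hermitian_iff_hinner matrix_vector_mult_diff_rdistrib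
      hinner_diff_left hinner_diff_right)

lemma conjugate_quad_form:
  "hermitian A \<Longrightarrow> conjugate (quad_form A x) = quad_form A x"
  unfolding quad_form_hinner by (metis hermitian_iff_hinner hinner_commute)

text \<open>Since \<open>A\<close> is self-adjoint, the two cross terms are conjugate to each other
  up to the factor \<open>c\<close>, so both can be written through
  \<open>hinner y (A *v x)\<close>.\<close>

lemma quad_form_add_scale:
  assumes "hermitian A"
  shows "quad_form A (x + c *s y) = quad_form A x + c * conjugate (hinner y (A *v x))
    + conjugate c * hinner y (A *v x) + conjugate c * c * quad_form A y"
proof -
  have "hinner x (A *v y) = conjugate (hinner y (A *v x))"
    using assms by (metis hermitian_iff_hinner hinner_commute)
  then show ?thesis
    by (simp add: quad_form_hinner vector_scalar_commute
        hinner_add_left hinner_add_right hinner_scale_left hinner_scale_right algebra_simps)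
qed

lemma quad_form_axis: "quad_form A (axis k 1) = A $ k $ k"
  by (simp add: quad_form_hinner hinner_axis_left matrix_vector_mult_axis)

section \<open>Kernel and Schur complement of a positive semidefinite matrix\<close>

text \<open>Put \<open>z = P *v x\<close>. Along the line \<open>z + t *s x\<close> with
  self-conjugate \<open>t\<close> the quadratic term vanishes, so the form is affine in
  \<open>t\<close>; if \<open>z\<close> were nonzero, its slope \<open>N + N\<close> would be
  nonzero and the form would take a negative value.\<close>

lemma pos_semidef_kernel:
  fixes P :: "'a::conjugatable_ordered_field^'n^'n"
  assumes "pos_semidef P" and "quad_form P x = 0"
  shows "P *v x = 0"
proof (rule ccontr)
  assume nz: "P *v x \<noteq> 0"
  define z where "z = P *v x"
  define N where "N = hinner z z"
  \<comment> \<open>Solves \<open>quad_form P z + t * (N + N) = - 1\<close>.\<close>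
  define t where "t = - (quad_form P z + 1) / (N + N)"
  have herm: "hermitian P" and nonneg: "\<And>x. 0 \<le> quad_form P x"
    using assms by (auto simp: pos_semidef_def)
  have "0 \<le> N" "N \<noteq> 0"
    using nz by (simp_all add: N_def z_def hinner_self_nonneg hinner_self_eq_0_iff)
  \<comment> \<open>A sum of nonnegative scalars vanishes only if each of them does.\<close>
  then have NN: "N + N \<noteq> 0"
    by (metis add_nonneg_eq_0_iff)
  have N: "conjugate N = N"
    unfolding N_def by (rule hinner_commute[symmetric])
  then have "conjugate (N + N) = N + N"
    by (metis conjugate_dist_add)
  then have t: "conjugate t = t"
    by (simp add: t_def conjugate_divide conjugate_neg conjugate_diff conjugate_dist_add
        conjugate_quad_form[OF herm])
  have xz: "hinner x (P *v z) = N"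
    using herm by (simp add: N_def z_def hermitian_iff_hinner)
  have "quad_form P (z + t *s x) = quad_form P z + t * (N + N)"
    unfolding quad_form_add_scale[OF herm] by (simp add: xz N t assms(2) algebra_simps)
  also have "\<dots> = - 1"
    using NN by (simp add: t_def)
  finally have "0 \<le> (- 1 :: 'a)"
    using nonneg by metis
  then have "0 + 1 \<le> (- 1 + 1 :: 'a)"
    by (rule add_right_mono)
  then show False
    using zero_less_one_conjugatable[where 'a = 'a] by simp
qed

definition outer :: "'a::conjugatable_field^'n \<Rightarrow> 'a \<Rightarrow> 'a^'n^'n"
  where "outer p a = (\<chi> i j. p $ i * conjugate (p $ j) / a)"

text \<open>The trace of \<open>G\<close> times the rank-one matrix \<open>p p*\<close> is the
  scalar \<open>p* G p\<close>.\<close>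

lemma trace_mult_outer: "trace (G ** outer p a) = quad_form G p / a"
  by (simp add: trace_def matrix_matrix_mult_def outer_def quad_form_def matrix_vector_mult_def
      sum_distrib_left sum_divide_distrib mult_ac)

text \<open>Completing the square: the value of the new form at \<open>x\<close> is the value of the
  form of \<open>P\<close> at \<open>x\<close> shifted along the \<open>k\<close>-th unit vector by
  \<open>- (b / P $ k $ k)\<close>, where \<open>b = (P *v x) $ k\<close>.\<close>

lemma pos_semidef_schur_complement:
  fixes P :: "'a::conjugatable_ordered_field^'n^'n"
  assumes "pos_semidef P" and a: "P $ k $ k \<noteq> 0"
  shows "pos_semidef (P - outer (column k P) (P $ k $ k))"
    (is "pos_semidef (P - ?O)")
proof -
  have herm: "hermitian P" and nonneg: "\<And>x. 0 \<le> quad_form P x"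
    using assms by (auto simp: pos_semidef_def)
  have c: "conjugate (P $ i $ j) = P $ j $ i" for i j
    using herm unfolding hermitian_def by metis
  have "hermitian ?O"
    by (simp add: hermitian_def outer_def column_def c conjugate_dist_mul conjugate_divide)
  with herm have "hermitian (P - ?O)"
    by (rule hermitian_diff)
  moreover have "0 \<le> quad_form (P - ?O) x" for x
  proof -
    define b where "b = (P *v x) $ k"
    \<comment> \<open>As \<open>P\<close> is Hermitian, the conjugate transpose of its
      \<open>k\<close>-th column is its \<open>k\<close>-th row, so it sends \<open>x\<close> to
      \<open>b\<close>.\<close>
    have "(?O *v x) = (b / P $ k $ k) *s column k P"
      by (simp add: vec_eq_iff outer_def column_def c matrix_vector_mult_def b_def
          sum_distrib_left sum_distrib_right sum_divide_distrib mult_ac)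
    moreover have "hinner x (column k P) = conjugate b"
      by (simp add: hinner_def b_def column_def matrix_vector_mult_def sum_conjugate c
          conjugate_dist_mul mult_ac)
    ultimately have "quad_form (P - ?O) x = quad_form P x - b * conjugate b / P $ k $ k"
      by (simp add: quad_form_hinner matrix_vector_mult_diff_rdistrib hinner_diff_right
          hinner_scale_right)
    also have "\<dots> = quad_form P (x + (- (b / P $ k $ k)) *s axis k 1)"
      unfolding quad_form_add_scale[OF herm]
      using a by (simp add: hinner_axis_left quad_form_axis conjugate_neg conjugate_divide c
          flip: b_def)
    finally show ?thesis using nonneg by simp
  qed
  ultimately show ?thesis by (simp add: pos_semidef_def)
qed

section \<open>Strict positivity of the weighted trace\<close>

lemma trace_mult_pos:
  fixes G P :: "'a::{conjugatable_ordered_field, ordered_comm_ring}^'n^'n"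
  assumes G: "pos_def G" and "pos_semidef P" and "P \<noteq> 0"
  shows "0 < trace (G ** P)"
  using assms(2,3)
proof (induction "card {i. P $ i $ i \<noteq> 0}" arbitrary: P rule: less_induct)
  case less
  have herm: "hermitian P" and nonneg: "\<And>x. 0 \<le> quad_form P x"
    using less.prems by (auto simp: pos_semidef_def)
  have "\<exists>k. P $ k $ k \<noteq> 0"
  proof (rule ccontr)
    assume "\<nexists>k. P $ k $ k \<noteq> 0"
    \<comment> \<open>A vanishing diagonal entry is a zero of the quadratic form at a unit vector,
      which therefore lies in the kernel.\<close>
    then have "P *v axis k 1 = 0" for k
      using pos_semidef_kernel[OF less.prems(1)] by (simp add: quad_form_axis)
    then have "P $ i $ k = 0" for i k
      by (metis matrix_vector_mult_axis zero_index)
    then show False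
      using less.prems(2) by (simp add: vec_eq_iff)
  qed
  then obtain k where k: "P $ k $ k \<noteq> 0" ..
  define a p Q where "a = P $ k $ k" and "p = column k P" and "Q = P - outer p a"
  have Q: "pos_semidef Q"
    unfolding Q_def a_def p_def by (rule pos_semidef_schur_complement[OF less.prems(1) k])
  have c: "conjugate (P $ i $ j) = P $ j $ i" for i j
    using herm unfolding hermitian_def by metis
  \<comment> \<open>Zeros on the diagonal survive the subtraction: the whole \<open>i\<close>-th
    column of \<open>P\<close> is zero, hence so is \<open>p $ i\<close>. Together with the new zero
    at \<open>k\<close> this makes the induction measure drop.\<close>
  have diag0: "Q $ i $ i = 0" if "P $ i $ i = 0" for i
  proof -
    have "P *v axis i 1 = 0"
      using that pos_semidef_kernel[OF less.prems(1)] by (simp add: quad_form_axis)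
    then have "P $ k $ i = 0"
      by (metis matrix_vector_mult_axis zero_index)
    then show ?thesis
      using that by (simp add: Q_def outer_def p_def column_def c)
  qed
  have "Q $ k $ k = 0"
    using k by (simp add: Q_def outer_def p_def a_def column_def c)
  with diag0 k have "{i. Q $ i $ i \<noteq> 0} \<subset> {i. P $ i $ i \<noteq> 0}"
    by blast
  then have card: "card {i. Q $ i $ i \<noteq> 0} < card {i. P $ i $ i \<noteq> 0}"
    by (simp add: psubset_card_mono)
  \<comment> \<open>\<open>Q\<close> may be zero, so only the weak inequality is available;
    strictness comes from the rank-one part.\<close>
  have "0 \<le> trace (G ** Q)"
  proof (cases "Q = 0")
    case True
    then show ?thesis by (simp add: trace_def)
  next
    case False
    then show ?thesis using less.hyps[OF card Q] by simp
  qed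
  moreover have "0 < trace (G ** outer p a)"
  proof -
    have "p \<noteq> 0"
      using k by (auto simp: p_def column_def vec_eq_iff)
    then have "0 < quad_form G p"
      using G by (simp add: pos_def_def)
    moreover have "0 < inverse a"
      using nonneg[of "axis k 1"] k c
      by (intro zero_less_inverse_if_conjugate_eq) (simp_all add: a_def quad_form_axis less_le)
    \<comment> \<open>The scalar order may be partial; strict positivity of the product is assembled
      from nonnegativity and nonvanishing.\<close>
    ultimately have "0 \<le> quad_form G p * inverse a" "quad_form G p * inverse a \<noteq> 0"
      by (simp_all add: less_imp_le less_le)
    then show ?thesis
      by (simp add: trace_mult_outer divide_inverse less_le)
  qed
  moreover have "trace (G ** P) = trace (G ** Q) + trace (G ** outer p a)"
    by (simp add: Q_def flip: trace_add matrix_add_ldistrib)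
  ultimately show ?case
    by (simp add: add_nonneg_pos)
qed

text \<open>By linearity, equal traces make the weighted trace of \<open>B - A\<close> vanish, which
  strict positivity forbids for a nonzero difference.\<close>

lemma eq_if_loewner_le_trace_eq:
  fixes A B G :: "'a::{conjugatable_ordered_field, ordered_comm_ring}^'n^'n"
  assumes "pos_def G" and "A \<preceq>\<^sub>L B" and "trace (G ** A) = trace (G ** B)"
  shows "A = B"
proof (rule ccontr)
  assume "A \<noteq> B"
  then have "0 < trace (G ** (B - A))"
    using assms by (intro trace_mult_pos) (auto simp: loewner_le_def)
  moreover have "trace (G ** B) = trace (G ** (B - A)) + trace (G ** A)"
    by (simp flip: trace_add matrix_add_ldistrib)
  ultimately show False
    using assms(3) by simp
qed

text \<open>Provides a positive definite weight, so that the statements for all weights imply those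
  for some weight.\<close>

lemma pos_def_mat_1: "pos_def (mat 1 :: 'a::conjugatable_ordered_field^'n^'n)"
proof -
  have "hermitian (mat 1 :: 'a^'n^'n)"
    by (simp add: hermitian_def mat_def)
  then show ?thesis
    by (auto simp: pos_def_def quad_form_hinner less_le hinner_self_nonneg hinner_self_eq_0_iff)
qed

section \<open>Inverses and the Loewner order\<close>

lemma matrix_inv_mult_vector:
  fixes A :: "'a::field^'n^'n"
  assumes "invertible A"
  shows "A *v (matrix_inv A *v x) = x"
proof -
  have "A ** matrix_inv A = mat 1"
    using assms unfolding invertible_def matrix_inv_def by (rule someI2_ex) simp
  then show ?thesis
    by (simp add: matrix_vector_mul_assoc)
qed

text \<open>Writing both vectors as images under \<open>A\<close> reduces self-adjointness of the
  inverse to that of \<open>A\<close>.\<close>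

lemma hermitian_matrix_inv:
  fixes A :: "'a::conjugatable_field^'n^'n"
  assumes "hermitian A" and "invertible A"
  shows "hermitian (matrix_inv A)"
  using assms unfolding hermitian_iff_hinner by (metis matrix_inv_mult_vector)

text \<open>With \<open>u\<close> and \<open>v\<close> the images of \<open>x\<close> under the two
  inverses, the form of the difference of the inverses at \<open>x\<close> equals
  \<open>quad_form A (u - v) + quad_form (B - A) v\<close>, a sum of two nonnegative terms. This
  avoids matrix square roots.\<close>

lemma loewner_le_matrix_inv:
  fixes A B :: "'a::conjugatable_ordered_field^'n^'n"
  assumes A: "pos_semidef A" "invertible A" and B: "pos_semidef B" "invertible B"
    and le: "A \<preceq>\<^sub>L B"
  shows "matrix_inv B \<preceq>\<^sub>L matrix_inv A"
proof -
  have hA: "hermitian A" and hB: "hermitian B"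
    using A B by (auto simp: pos_semidef_def)
  have "0 \<le> quad_form (matrix_inv A - matrix_inv B) x" for x
  proof -
    define u v where "u = matrix_inv A *v x" and "v = matrix_inv B *v x"
    have Au: "A *v u = x" and Bv: "B *v v = x"
      using A B by (simp_all add: u_def v_def matrix_inv_mult_vector)
    \<comment> \<open>These symmetries express the cross terms through \<open>hinner x u\<close> and
      \<open>hinner x v\<close>, after which the identity is a cancellation.\<close>
    have "hinner u (A *v v) = hinner x v"
      using hA Au by (simp add: hermitian_iff_hinner)
    moreover have "hinner v x = hinner x v"
      using hB Bv by (metis hermitian_iff_hinner)
    moreover have "hinner u x = hinner x u"
      using hA Au by (metis hermitian_iff_hinner)
    ultimately have "quad_form (matrix_inv A - matrix_inv B) x
        = quad_form A (u - v) + quad_form (B - A) v"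
      by (simp add: quad_form_hinner matrix_vector_mult_diff_rdistrib
          matrix_vector_mult_diff_distrib hinner_diff_left hinner_diff_right Au Bv
          flip: u_def v_def)
    also have "0 \<le> \<dots>"
      using A le by (simp add: pos_semidef_def loewner_le_def)
    finally show ?thesis .
  qed
  then show ?thesis
    using A B hA hB by (simp add: loewner_le_def pos_semidef_def hermitian_diff hermitian_matrix_inv)
qed

lemma matrix_inv_eq_iff:
  fixes A B :: "'a::field^'n^'n"
  assumes "invertible A" and "invertible B"
  shows "matrix_inv A = matrix_inv B \<longleftrightarrow> A = B"
proof
  assume eq: "matrix_inv A = matrix_inv B"
  have *: "A ** matrix_inv A = mat 1" "matrix_inv B ** B = mat 1"
    using assms unfolding invertible_def matrix_inv_def by (auto intro: someI2_ex)
  from * show "A = B"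
    by (metis eq matrix_mul_assoc matrix_mul_lid matrix_mul_rid)
qed simp

text \<open>Statements (iv) and (v) speak of inverses, so their equivalence with (ii) is stated
  under invertibility of both matrices: \<open>matrix_inv\<close> of a singular matrix is an
  unspecified choice.\<close>

theorem lemma2:
  fixes A B :: "'a::{real_normed_field, conjugatable_ordered_field, ordered_comm_ring}^'n::finite^'n"
  assumes "pos_semidef A" and "pos_semidef B" and "A \<preceq>\<^sub>L B"
  shows "((\<exists>G\<^sub>0. pos_def G\<^sub>0 \<and> trace (G\<^sub>0 ** A) = trace (G\<^sub>0 ** B)) \<longleftrightarrow> A = B) \<and>
    (A = B \<longleftrightarrow> (\<forall>G. pos_def G \<longrightarrow> trace (G ** A) = trace (G ** B))) \<and>
    (invertible A \<and> invertible B \<longrightarrow>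
      (A = B \<longleftrightarrow>
        (\<exists>G\<^sub>0. pos_def G\<^sub>0 \<and> trace (G\<^sub>0 ** matrix_inv A) = trace (G\<^sub>0 ** matrix_inv B))) \<and>
      (A = B \<longleftrightarrow>
        (\<forall>G. pos_def G \<longrightarrow> trace (G ** matrix_inv A) = trace (G ** matrix_inv B))))"
proof -
  have 1: "A = B" if "pos_def G" "trace (G ** A) = trace (G ** B)" for G
    using that assms(3) by (metis eq_if_loewner_le_trace_eq)
  have 2: "A = B" if "invertible A" "invertible B" "pos_def G"
    "trace (G ** matrix_inv A) = trace (G ** matrix_inv B)" for G
    using that eq_if_loewner_le_trace_eq[OF _ loewner_le_matrix_inv] assms
    by (metis matrix_inv_eq_iff)
  show ?thesis
    \<comment> \<open>Equality gives the universal statements by substitution, the weight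
      \<open>mat 1\<close> turns these into the existential ones, and facts \<open>1\<close> and
      \<open>2\<close> lead back to equality.\<close>
    using 1 2 pos_def_mat_1 by metis
qed

end
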